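(* Let $\mathcal{H}$, $\mathcal{V}$, $\mathcal{H}^\ast$, $\mathcal{G}$ be the classes of distributions defined in the context. Then: (vi) Let $X$ and $Y$ be independent. - If $X,Y\in\mathcal{G}$, then $\max\{X,Y\}\in\mathcal{G}$. - If $X,Y\in\mathcal{H}$, then $\max\{X,Y\}\in\mathcal{H}$. - If $X,Y\in\mathcal{V}$ [resp. $X,Y\in\mathcal{H}^\ast$], then $\max\{X,Y\}\in\mathcal{V}$ [resp. $\mathcal{H}^\ast$]. (vii) If $X\in\mathcal{H}$, then $(X-c)_+\in\mathcal{H}$ for any $c\in\mathbb{R}_{++}$. If $X\in\mathcal{V}$ [resp. $X\in\mathcal{G}$, $X\in\mathcal{H}^\ast$], then $(X-c)_+\in\mathcal{V}$ [resp. $\mathcal{G}$, $\mathcal{H}^\ast$] for any $c\in\mathbb{R}_{++}$. (viii) Let $X$ and $Y$ be independent such that $X\in\mathcal{V}$ [resp. $X\in\mathcal{H}$, $X\in\mathcal{G}$, $X\in\mathcal{H}^\ast$]. If $Y$ is nonnegative, then $(X-Y)_+\in\mathcal{V}$ [resp. $\mathcal{H}$, $\mathcal{G}$, $\mathcal{H}^\ast$]. (ix) If $X\in\mathcal{V}$ [resp. $X\in\mathcal{H}$, $X\in\mathcal{H}^\ast$], then $[X\mid X>c]\in\mathcal{V}$ [resp. $\mathcal{H}$, $\mathcal{H}^\ast$] for any $c\in\mathbb{R}_{++}$. However, for any $X$ belonging to one of $\mathcal{V}$, $\mathcal{H}$, $\mathcal{H}^\ast$, $[X\mid X>c]\notin\mathcal{G}$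 for any $c\in\mathbb{R}_{++}$.
   Context: All random variables are nonnegative unless stated otherwise. $\mathbb{R}_+=[0,\infty)$, $\mathbb{R}_{++}=(0,\infty)$, $a_+=\max\{a,0\}$. "Increasing" means nondecreasing. For a distribution function $F$, $\overline F=1-F$, and $F(0-)$ is the left limit of $F$ at $0$. A function $\varphi$ is subadditive if $\varphi(x+y)\le\varphi(x)+\varphi(y)$ for all $x,y$ in its domain. Let $F$ be a non-degenerate distribution function (i.e. not that of a constant) with $F(0-)=0$. - $F\in\mathcal{V}$ if $\theta\,\overline F(x)\le \overline F(x/\theta)$ for all $x\in\mathbb{R}_+$ and all $\theta\in(0,1)$ (equivalently, $x\overline F(x)$ is increasing in $x\in\mathbb{R}_+$). - $F\in\mathcal{H}$ if $x\mapsto\overline F(1/x)$ is concave on $\mathbb{R}_{++}$. - $F\in\mathcal{H}^\ast$ if $x\mapsto\overline F(1/x)$ is subadditive on $\mathbb{R}_{++}$. - $F\in\mathcal{G}$ if $\Lambda_F(x)=-\log F(1/x)$ is subadditive on $\mathbb{R}_{++}$ (with $\log 0=-\infty$), i.e. $F\left(\frac{1}{x+y}\right)\ge F\left(\frac1x\right)F\left(\frac1y\right)$ for all $x,y>0$. For a random variable $X$ and a class $\mathcal{T}$ of distribution functions, $X\in\mathcal{T}$ means that the distribution function of $X$ belongs to $\mathcal{T}$. $[X\mid X>c]$ denotes a random variable whose distribution is the conditional distribution of $X$ given $X>c$. *)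

theory Defs
  imports "HOL-Probability.Probability"
begin

definition distribution_function :: "(real \<Rightarrow> real) \<Rightarrow> bool" where
  "distribution_function F \<longleftrightarrow> (\<exists>\<mu>. real_distribution \<mu> \<and> F = cdf \<mu>)"

definition degenerate :: "(real \<Rightarrow> real) \<Rightarrow> bool" where
  "degenerate F \<longleftrightarrow> (\<exists>a. F = cdf (return borel a))"

text \<open>Standing assumption of all four classes. The limit says F(0-) = 0; an atom at 0 is allowed.\<close>

definition admissible_df :: "(real \<Rightarrow> real) \<Rightarrow> bool" where
  "admissible_df F \<longleftrightarrow> distribution_function F \<and> \<not> degenerate F \<and> (F \<longlongrightarrow> 0) (at_left 0)"

abbreviation survival :: "(real \<Rightarrow> real) \<Rightarrow> real \<Rightarrow> real" where
  "survival F x \<equiv> 1 - F x"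

definition subadditive_on :: "real set \<Rightarrow> (real \<Rightarrow> 'b::{plus,ord}) \<Rightarrow> bool" where
  "subadditive_on S f \<longleftrightarrow> (\<forall>x\<in>S. \<forall>y\<in>S. f (x + y) \<le> f x + f y)"

text \<open>Extended-real valued, because F may vanish near 0: where F(1/x) = 0 the value is
  \<open>- log 0 = \<infinity>\<close>, whereas the real-valued \<open>ln\<close> satisfies \<open>ln 0 = 0\<close>.\<close>

definition neg_log_df :: "(real \<Rightarrow> real) \<Rightarrow> real \<Rightarrow> ereal" where
  "neg_log_df F x = (if F (1 / x) = 0 then \<infinity> else ereal (- ln (F (1 / x))))"

definition class_V :: "(real \<Rightarrow> real) set" where
  "class_V = {F. admissible_df F \<and>
     (\<forall>x\<ge>0. \<forall>\<theta>\<in>{0<..<1}. \<theta> * survival F x \<le> survival F (x / \<theta>))}"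

definition class_H :: "(real \<Rightarrow> real) set" where
  "class_H = {F. admissible_df F \<and> concave_on {0<..} (\<lambda>x. survival F (1 / x))}"

definition class_H_star :: "(real \<Rightarrow> real) set" where
  "class_H_star = {F. admissible_df F \<and> subadditive_on {0<..} (\<lambda>x. survival F (1 / x))}"

definition class_G :: "(real \<Rightarrow> real) set" where
  "class_G = {F. admissible_df F \<and> subadditive_on {0<..} (neg_log_df F)}"

lemma class_G_iff:
  "F \<in> class_G \<longleftrightarrow> admissible_df F \<and>
     (\<forall>x>0. \<forall>y>0. F (1 / (x + y)) \<ge> F (1 / x) * F (1 / y))"
proof -
  have "neg_log_df F (x + y) \<le> neg_log_df F x + neg_log_df F y \<longleftrightarrow>
        F (1 / (x + y)) \<ge> F (1 / x) * F (1 / y)" if F: "admissible_df F" for x y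
  proof -
    have nn: "F t \<ge> 0" for t
      using F by (auto simp: admissible_df_def distribution_function_def cdf_def)
    define a b c where "a = F (1 / x)" and "b = F (1 / y)" and "c = F (1 / (x + y))"
    have abc: "a \<ge> 0" "b \<ge> 0" "c \<ge> 0" by (simp_all add: a_def b_def c_def nn)
    show ?thesis
    proof (cases "a = 0 \<or> b = 0 \<or> c = 0")
      case True
      then show ?thesis
        using abc unfolding neg_log_df_def a_def[symmetric] b_def[symmetric] c_def[symmetric]
        by (auto simp: mult_le_0_iff)
    next
      case False
      then have pos: "a > 0" "b > 0" "c > 0" using abc by auto
      have "- ln c \<le> - ln a + - ln b \<longleftrightarrow> ln (a * b) \<le> ln c"
        using pos by (auto simp: ln_mult)
      also have "\<dots> \<longleftrightarrow> a * b \<le> c"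
        using pos by simp
      finally show ?thesis
        using pos unfolding neg_log_df_def a_def[symmetric] b_def[symmetric] c_def[symmetric]
        by simp
    qed
  qed
  then show ?thesis
    by (auto simp: class_G_def subadditive_on_def)
qed

definition rv_in_class :: "'a measure \<Rightarrow> ('a \<Rightarrow> real) \<Rightarrow> (real \<Rightarrow> real) set \<Rightarrow> bool" where
  "rv_in_class M X T \<longleftrightarrow> cdf (distr M borel X) \<in> T"

text \<open>The law of [X | X > c] is realised by X itself on the sample space conditioned on the
  event \<open>X > c\<close>.\<close>

definition cond_exceeds :: "'a measure \<Rightarrow> ('a \<Rightarrow> real) \<Rightarrow> real \<Rightarrow> 'a measure" where
  "cond_exceeds M X c = uniform_measure M {\<omega> \<in> space M. X \<omega> > c}"

end

theory Submission
  imports Defs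
begin

text \<open>
  Pass to the reciprocal variable: put \<open>g x = 1 - F (1 / x)\<close> for \<open>x > 0\<close>. Then \<open>g\<close> is increasing, and
  class V says that \<open>g\<close> is star-shaped (\<open>\<theta> * g x \<le> g (\<theta> * x)\<close>), H that it is concave, H* that it is
  subadditive, and G that \<open>1 - g\<close> is supermultiplicative. Everything happens on this level.

  Non-degeneracy is handled once for all four classes. Each condition forces
  \<open>survival F t \<le> 3 * survival F (2 * t)\<close>; a tail that vanishes somewhere would then vanish on all of
  \<open>(0, \<infinity>)\<close>, so that \<open>F\<close> would be the point mass at 0. Hence \<open>F x < 1\<close> for all \<open>x\<close>
  (\<open>class_imp_less_1\<close>). Each construction below again produces a distribution function that stays
  below 1, and this already excludes a point mass (\<open>admissible_dfI\<close>).

  Maxima (\<open>product_in_class\<close>): the distribution functions multiply, so two functions \<open>1 - g\<close> with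
  values in \<open>[0, 1]\<close> that move in the same direction are multiplied. The bound obtained by multiplying
  the two given inequalities is at least as strong as the desired one in every class.

  Subtraction and conditioning replace \<open>g\<close> by \<open>g \<circ> h\<close> with \<open>h\<close> concave and \<open>h 0 = 0\<close>: subtracting a
  constant \<open>c\<close> gives \<open>h x = x / (1 + c * x)\<close>, and conditioning on exceeding \<open>c\<close> gives
  \<open>h x = min x (1 / c)\<close> together with a division by \<open>g (1 / c)\<close>. Such an \<open>h\<close> is star-shaped,
  subadditive and concave, and \<open>g\<close> is increasing, so \<open>g \<circ> h\<close> inherits each condition
  (locale \<open>concave_change\<close>). Subtracting an independent \<open>Y\<close> averages these functions over the values
  of \<open>Y\<close>. The conditions of V, H and H* are linear in \<open>g\<close> and survive averaging; that of G is not
  linear, but \<open>F (1 / x + Y)\<close> and \<open>F (1 / y + Y)\<close> are increasing functions of the same variable and hence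
  nonnegatively correlated (\<open>Chebyshev_association\<close>), which is the correct direction.

  Finally, the supermultiplicativity in G gives \<open>(F (2 * t))\<^sup>2 \<le> F t\<close>, so a zero of \<open>F\<close> at a positive
  point would spread to all larger points and contradict \<open>F \<rightarrow> 1\<close>. The conditional law given
  \<open>X > c\<close> puts no mass on \<open>[0, c]\<close>, so it is never in G.
\<close>

section \<open>Admissible distribution functions and the reciprocal variable\<close>

abbreviation inv_survival :: "(real \<Rightarrow> real) \<Rightarrow> real \<Rightarrow> real" where
  "inv_survival F x \<equiv> 1 - F (1 / x)"

lemma admissible_dfD:
  assumes "admissible_df F"
  shows admissible_df_mono: "x \<le> y \<Longrightarrow> F x \<le> F y"
    and admissible_df_nonneg: "0 \<le> F x"
    and admissible_df_le_1: "F x \<le> 1"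
    and admissible_df_neg: "x < 0 \<Longrightarrow> F x = 0"
proof -
  from assms obtain \<mu> where \<mu>: "real_distribution \<mu>" and F: "F = cdf \<mu>"
    and lim: "(F \<longlongrightarrow> 0) (at_left 0)"
    by (auto simp: admissible_df_def distribution_function_def)
  interpret real_distribution \<mu> by fact
  show mono: "F x \<le> F y" if "x \<le> y" for x y
    using that by (simp add: F cdf_nondecreasing)
  show nn: "0 \<le> F x" for x by (simp add: F cdf_nonneg)
  show "F x \<le> 1" by (simp add: F cdf_bounded_prob)
  assume "x < 0"
  then have "eventually (\<lambda>y. x < y \<and> y < 0) (at_left (0::real))"
    using eventually_at_left_real[of x 0] by simp
  then have "eventually (\<lambda>y. F x \<le> F y) (at_left 0)"
    by eventually_elim (auto intro: mono)
  then have "F x \<le> 0"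
    by (intro tendsto_lowerbound[OF lim]) auto
  with nn show "F x = 0" by (simp add: antisym)
qed

lemma inv_survival_mono:
  assumes "admissible_df F" "0 < x" "x \<le> y"
  shows "inv_survival F x \<le> inv_survival F y"
  using assms by (auto intro!: admissible_df_mono[OF assms(1)] simp: frac_le)

lemma degenerate_eq_step:
  "degenerate F \<longleftrightarrow> (\<exists>a. F = (\<lambda>x. if x < a then 0 else 1))"
proof -
  have "cdf (return borel a) = (\<lambda>x. if x < a then 0 else 1)" for a :: real
    by (auto simp: cdf_def measure_return indicator_def)
  then show ?thesis by (simp add: degenerate_def)
qed

text \<open>A point mass reaches the value 1, so a distribution function that stays below 1 is not degenerate.\<close>

lemma admissible_dfI:
  assumes "distribution_function F" and neg: "\<And>x. x < 0 \<Longrightarrow> F x = 0" and lt: "\<And>x. F x < 1"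
  shows "admissible_df F"
proof -
  have "\<not> degenerate F"
    using lt by (auto simp: degenerate_eq_step) (metis less_irrefl)
  moreover have "(F \<longlongrightarrow> 0) (at_left 0)"
    by (rule tendsto_eventually) (auto simp: eventually_at_filter neg)
  ultimately show ?thesis using assms(1) by (simp add: admissible_df_def)
qed

text \<open>If \<open>F\<close> reaches 1 at some point, then halving the argument repeatedly carries the value 1 arbitrarily
  close to 0, and right-continuity carries it to 0 itself: \<open>F\<close> is then the point mass at 0, which is
  degenerate.\<close>

lemma survival_doubling_imp_less_1:
  assumes F: "admissible_df F"
    and doubling: "\<And>t. t > 0 \<Longrightarrow> survival F t \<le> 3 * survival F (2 * t)"
  shows "F x < 1"
proof (rule ccontr)
  assume "\<not> F x < 1"
  then have x1: "F x = 1" using admissible_df_le_1[OF F, of x] by simp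
  have x0: "x \<ge> 0" using admissible_df_neg[OF F, of x] x1 by force
  define t where "t = x + 1"
  have t: "t > 0" "F t = 1"
    using x0 admissible_df_mono[OF F, of x t] admissible_df_le_1[OF F, of t] x1
    by (auto simp: t_def)
  have halves: "F (t / 2 ^ n) = 1" for n
  proof (induction n)
    case (Suc n)
    have "survival F (t / 2 ^ Suc n) \<le> 3 * survival F (2 * (t / 2 ^ Suc n))"
      using t by (intro doubling) simp
    with Suc show ?case using admissible_df_le_1[OF F, of "t / 2 ^ Suc n"] by simp
  qed (simp add: t)
  have pos: "F y = 1" if "y > 0" for y
  proof -
    obtain n where "t / y < 2 ^ n" using real_arch_pow[of 2 "t / y"] by auto
    then have "t / 2 ^ n \<le> y" using that by (simp add: field_simps)
    then show ?thesis
      using admissible_df_mono[OF F, of "t / 2 ^ n" y] halves[of n] admissible_df_le_1[OF F, of y] by simp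
  qed
  obtain \<mu> where \<mu>: "real_distribution \<mu>" and F_cdf: "F = cdf \<mu>"
    using F by (auto simp: admissible_df_def distribution_function_def)
  interpret real_distribution \<mu> by fact
  have "(F \<longlongrightarrow> F 0) (at_right 0)"
    using cdf_is_right_cont[of 0] by (simp add: F_cdf continuous_within)
  moreover have "(F \<longlongrightarrow> 1) (at_right 0)"
    by (rule tendsto_eventually) (auto simp: eventually_at_filter pos)
  ultimately have "F 0 = 1"
    by (intro tendsto_unique[of "at_right 0" F]) auto
  then have "F = (\<lambda>x. if x < 0 then 0 else 1)"
    using pos admissible_df_neg[OF F] by (auto simp: fun_eq_iff) (metis linorder_neqE_linordered_idom)
  then show False
    using F by (auto simp: admissible_df_def degenerate_eq_step)
qed

text \<open>The defining inequality at \<open>1 / x\<close>. At the point 0, which has no reciprocal, it holds because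
  \<open>\<theta> * survival F 0 \<le> survival F 0\<close>.\<close>

lemma class_V_iff:
  "F \<in> class_V \<longleftrightarrow> admissible_df F \<and>
     (\<forall>x>0. \<forall>\<theta>\<in>{0<..<1}. \<theta> * inv_survival F x \<le> inv_survival F (\<theta> * x))"
proof -
  have "(\<forall>x\<ge>0. \<forall>\<theta>\<in>{0<..<1}. \<theta> * survival F x \<le> survival F (x / \<theta>)) \<longleftrightarrow>
        (\<forall>x>0. \<forall>\<theta>\<in>{0<..<1}. \<theta> * inv_survival F x \<le> inv_survival F (\<theta> * x))"
    (is "?L \<longleftrightarrow> ?R") if F: "admissible_df F"
  proof
    assume L: ?L
    show ?R
    proof (intro allI impI ballI)
      fix x \<theta> :: real assume "x > 0" "\<theta> \<in> {0<..<1}"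
      then show "\<theta> * inv_survival F x \<le> inv_survival F (\<theta> * x)"
        using L[rule_format, of "1 / x" \<theta>] by (simp add: mult.commute)
    qed
  next
    assume R: ?R
    show ?L
    proof (intro allI impI ballI)
      fix x \<theta> :: real assume "x \<ge> 0" and \<theta>: "\<theta> \<in> {0<..<1}"
      show "\<theta> * survival F x \<le> survival F (x / \<theta>)"
      proof (cases "x = 0")
        case True
        then show ?thesis
          using \<theta> admissible_df_le_1[OF F, of 0] by (simp add: mult_left_le_one_le)
      next
        case False
        then show ?thesis
          using R[rule_format, of "1 / x" \<theta>] \<theta> \<open>x \<ge> 0\<close> by simp
      qed
    qed
  qed
  then show ?thesis by (auto simp: class_V_def)
qed

lemma class_H_star_iff:
  "F \<in> class_H_star \<longleftrightarrow> admissible_df F \<and>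
     (\<forall>x>0. \<forall>y>0. inv_survival F (x + y) \<le> inv_survival F x + inv_survival F y)"
  by (auto simp: class_H_star_def subadditive_on_def)

lemma class_imp_admissible:
  assumes "F \<in> T" "T \<in> {class_G, class_H, class_V, class_H_star}"
  shows "admissible_df F"
  using assms by (auto simp: class_G_def class_H_def class_V_def class_H_star_def)

text \<open>Members of all four classes have unbounded support. The constant 3 is what concavity gives: \<open>1 / (2 * t)\<close>
  lies between \<open>1 / (4 * t)\<close> and \<open>1 / t\<close>, and divides this segment in the ratio 1 : 2. The other classes
  give the constant 2.\<close>

lemma class_imp_less_1:
  assumes T: "F \<in> T" "T \<in> {class_G, class_H, class_V, class_H_star}"
  shows "F x < 1"
proof (rule survival_doubling_imp_less_1[of F])
  show F: "admissible_df F" using class_imp_admissible[OF T] .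
  fix t :: real assume t: "t > 0"
  define a b where "a = survival F t" and "b = survival F (2 * t)"
  have b: "0 \<le> b" using admissible_df_le_1[OF F] by (simp add: b_def)
  have half: "1 / (1 / (2 * t) + 1 / (2 * t)) = t" using t by (simp add: field_simps)
  consider "F \<in> class_G" | "F \<in> class_H" | "F \<in> class_V" | "F \<in> class_H_star"
    using T by auto
  then have "a \<le> 3 * b"
  proof cases
    case 1
    have "F (1 / (1 / (2 * t) + 1 / (2 * t))) \<ge> F (1 / (1 / (2 * t))) * F (1 / (1 / (2 * t)))"
      using 1 t unfolding class_G_iff by (meson zero_less_divide_1_iff mult_pos_pos zero_less_numeral)
    then have "F (2 * t) * F (2 * t) \<le> F t"
      unfolding half by simp
    then have "(1 - b) * (1 - b) \<le> 1 - a" by (simp add: a_def b_def)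
    then have "a \<le> 2 * b - b * b" by (simp add: algebra_simps)
    then show ?thesis using b by (smt (verit) mult_nonneg_nonneg)
  next
    case 2
    have point: "(1 - 2/3) *\<^sub>R (1 / t) + (2/3) *\<^sub>R (1 / (4 * t)) = 1 / (2 * t)"
      using t by (simp add: field_simps)
    have "concave_on {0<..} (inv_survival F)" using 2 by (simp add: class_H_def)
    from concave_onD[OF this, of "2/3" "1 / t" "1 / (4 * t)", unfolded point]
    have "(1/3) * a + (2/3) * survival F (4 * t) \<le> b"
      using t by (simp add: a_def b_def)
    moreover have "0 \<le> (2/3) * survival F (4 * t)"
      using admissible_df_le_1[OF F, of "4 * t"] by simp
    ultimately have "(1/3) * a \<le> b" by linarith
    then show ?thesis by simp
  next
    case 3
    have "1 / t > 0" "1 / 2 \<in> {0<..<1 :: real}" using t by auto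
    then have "(1/2) * inv_survival F (1 / t) \<le> inv_survival F ((1/2) * (1 / t))"
      using 3 unfolding class_V_iff by blast
    then show ?thesis using b by (simp add: a_def b_def mult.commute)
  next
    case 4
    have "inv_survival F (1 / (2 * t) + 1 / (2 * t)) \<le> inv_survival F (1 / (2 * t)) + inv_survival F (1 / (2 * t))"
      using 4 t unfolding class_H_star_iff by (meson zero_less_divide_1_iff mult_pos_pos zero_less_numeral)
    then show ?thesis using b unfolding half by (simp add: a_def b_def)
  qed
  then show "survival F t \<le> 3 * survival F (2 * t)" by (simp add: a_def b_def)
qed

text \<open>Taking \<open>x = y = 1 / (2 * t)\<close> in the condition of G gives \<open>F (2 * t) * F (2 * t) \<le> F t\<close>, so a zero at
  \<open>t\<close> propagates to \<open>2 * t\<close>, and by monotonicity \<open>F\<close> would vanish identically.\<close>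

lemma class_G_pos:
  assumes G: "F \<in> class_G" and x: "x > 0"
  shows "F x > 0"
proof (rule ccontr)
  have F: "admissible_df F" using class_imp_admissible[OF G] by simp
  assume "\<not> F x > 0"
  then have x0: "F x = 0" using admissible_df_nonneg[OF F, of x] by simp
  have zero: "F (2 ^ n * x) = 0" for n
  proof (induction n)
    case (Suc n)
    define t where "t = 2 ^ n * x"
    have t: "t > 0" using x by (simp add: t_def)
    have "F (1 / (1 / (2 * t) + 1 / (2 * t))) \<ge> F (1 / (1 / (2 * t))) * F (1 / (1 / (2 * t)))"
      using G t unfolding class_G_iff by (meson zero_less_divide_1_iff mult_pos_pos zero_less_numeral)
    moreover have "1 / (1 / (2 * t) + 1 / (2 * t)) = t" using t by (simp add: field_simps)
    moreover have "F t = 0" using Suc by (simp add: t_def)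
    ultimately have "F (2 * t) * F (2 * t) \<le> 0" by simp
    then have "F (2 * t) = 0" by (simp add: mult_le_0_iff antisym admissible_df_nonneg[OF F])
    then show ?case by (simp add: t_def mult.assoc)
  qed (simp add: x0)
  have all0: "F y = 0" for y
  proof -
    obtain n where "y / x < 2 ^ n" using real_arch_pow[of 2 "y / x"] by auto
    then have "y \<le> 2 ^ n * x" using x by (simp add: field_simps)
    then show ?thesis
      using admissible_df_mono[OF F] zero[of n] admissible_df_nonneg[OF F, of y] by fastforce
  qed
  obtain \<mu> where \<mu>: "real_distribution \<mu>" and F_cdf: "F = cdf \<mu>"
    using F by (auto simp: admissible_df_def distribution_function_def)
  interpret real_distribution \<mu> by fact
  have "(F \<longlongrightarrow> 1) at_top" using cdf_lim_at_top_prob by (simp add: F_cdf)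
  moreover have "F = (\<lambda>_. 0)" using all0 by auto
  ultimately have "((\<lambda>_. 0 :: real) \<longlongrightarrow> 1) (at_top :: real filter)" by simp
  then show False by (simp add: tendsto_const_iff)
qed

section \<open>Maxima: products of distribution functions\<close>

text \<open>For G the inequalities are simply multiplied. In the other classes the bound obtained by
  multiplying is stronger than the desired one by a nonnegative term. With \<open>p\<close>, \<open>q\<close> the values of the two
  reciprocal survival functions, the term is \<open>u * v\<close> times \<open>(p x - p y) * (q x - q y)\<close> for H,
  \<open>\<theta> * (1 - \<theta>) * p x * q x\<close> for V, and \<open>p x * q y + p y * q x\<close> for H*. The first is nonnegative since
  both functions are increasing.\<close>

lemma product_in_class:
  assumes F1: "F1 \<in> T" and F2: "F2 \<in> T" and T: "T \<in> {class_G, class_H, class_V, class_H_star}"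
    and df: "distribution_function (\<lambda>x. F1 x * F2 x)"
  shows "(\<lambda>x. F1 x * F2 x) \<in> T"
proof -
  note A1 = class_imp_admissible[OF F1 T] and A2 = class_imp_admissible[OF F2 T]
  note nn = admissible_df_nonneg[OF A1] admissible_df_nonneg[OF A2]
  note le1 = admissible_df_le_1[OF A1] admissible_df_le_1[OF A2]
  have lt: "F1 x * F2 x < 1" for x
    using class_imp_less_1[OF F1 T, of x] mult_left_le[of "F2 x" "F1 x"] nn le1 by (meson le_less_trans)
  have adm: "admissible_df (\<lambda>x. F1 x * F2 x)"
    using df lt by (intro admissible_dfI) (auto simp: admissible_df_neg[OF A1])
  consider "T = class_G" | "T = class_H" | "T = class_V" | "T = class_H_star" using T by auto
  then show ?thesis
  proof cases
    case 1
    have "F1 (1 / x) * F2 (1 / x) * (F1 (1 / y) * F2 (1 / y)) \<le> F1 (1 / (x + y)) * F2 (1 / (x + y))"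
      if "x > 0" "y > 0" for x y
    proof -
      have "(F1 (1 / x) * F1 (1 / y)) * (F2 (1 / x) * F2 (1 / y)) \<le> F1 (1 / (x + y)) * F2 (1 / (x + y))"
        using F1 F2 that nn unfolding 1 class_G_iff by (intro mult_mono) auto
      then show ?thesis by (simp add: mult_ac)
    qed
    with adm show ?thesis by (simp add: 1 class_G_iff)
  next
    case 2
    let ?p = "inv_survival F1" and ?q = "inv_survival F2"
    have "u * (1 - F1 (1/x) * F2 (1/x)) + v * (1 - F1 (1/y) * F2 (1/y))
        \<le> 1 - F1 (1 / (u * x + v * y)) * F2 (1 / (u * x + v * y))"
      if xy: "x > 0" "y > 0" and uv: "u \<ge> 0" "v \<ge> 0" "u + v = 1" for x y u v :: real
    proof -
      let ?z = "u * x + v * y"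
      have c1: "u * ?p x + v * ?p y \<le> ?p ?z" and c2: "u * ?q x + v * ?q y \<le> ?q ?z"
        using F1 F2 xy uv unfolding 2 class_H_def concave_on_iff by auto
      have u: "u = 1 - v" using uv by simp
      have "F1 (1 / ?z) * F2 (1 / ?z)
          \<le> (u * F1 (1 / x) + v * F1 (1 / y)) * (u * F2 (1 / x) + v * F2 (1 / y))"
        using c1 c2 uv nn by (intro mult_mono add_nonneg_nonneg mult_nonneg_nonneg) (auto simp: u algebra_simps)
      also have "\<dots> = u * (F1 (1/x) * F2 (1/x)) + v * (F1 (1/y) * F2 (1/y))
          - u * v * ((F1 (1/x) - F1 (1/y)) * (F2 (1/x) - F2 (1/y)))"
        by (simp add: u algebra_simps)
      also have "\<dots> \<le> u * (F1 (1/x) * F2 (1/x)) + v * (F1 (1/y) * F2 (1/y))"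
      proof -
        have "0 \<le> (F1 (1/x) - F1 (1/y)) * (F2 (1/x) - F2 (1/y))"
        proof (cases "1 / x \<le> 1 / y")
          case True
          then show ?thesis
            using admissible_df_mono[OF A1 True] admissible_df_mono[OF A2 True] by (simp add: mult_nonpos_nonpos)
        next
          case False
          then have "1 / y \<le> 1 / x" by simp
          from admissible_df_mono[OF A1 this] admissible_df_mono[OF A2 this] show ?thesis by simp
        qed
        then show ?thesis using uv by simp
      qed
      finally show ?thesis using uv by (simp add: u algebra_simps)
    qed
    with adm show ?thesis by (auto simp: 2 class_H_def concave_on_iff)
  next
    case 3
    have "\<theta> * (1 - F1 (1/x) * F2 (1/x)) \<le> 1 - F1 (1 / (\<theta> * x)) * F2 (1 / (\<theta> * x))"
      if x: "x > 0" and \<theta>: "\<theta> \<in> {0<..<1}" for x \<theta>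
    proof -
      let ?p = "inv_survival F1 x" and ?q = "inv_survival F2 x"
      have "\<theta> * ?p \<le> inv_survival F1 (\<theta> * x)" "\<theta> * ?q \<le> inv_survival F2 (\<theta> * x)"
        using F1 F2 x \<theta> unfolding 3 class_V_iff by auto
      moreover have "\<theta> * ?p \<le> 1" "\<theta> * ?q \<le> 1"
        using \<theta> nn le1 by (auto intro!: mult_le_one)
      ultimately have "F1 (1 / (\<theta> * x)) * F2 (1 / (\<theta> * x)) \<le> (1 - \<theta> * ?p) * (1 - \<theta> * ?q)"
        using nn by (intro mult_mono) auto
      also have "\<dots> = 1 - \<theta> * (?p + ?q - ?p * ?q) - \<theta> * (1 - \<theta>) * (?p * ?q)"
        by (simp add: algebra_simps)
      also have "\<dots> \<le> 1 - \<theta> * (?p + ?q - ?p * ?q)"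
        using \<theta> le1 by simp
      finally show ?thesis by (simp add: algebra_simps)
    qed
    with adm show ?thesis by (simp add: 3 class_V_iff)
  next
    case 4
    have "1 - F1 (1 / (x + y)) * F2 (1 / (x + y))
        \<le> (1 - F1 (1/x) * F2 (1/x)) + (1 - F1 (1/y) * F2 (1/y))"
      if xy: "x > 0" "y > 0" for x y
    proof -
      define a b a' b' where "a = F1 (1/x)" and "b = F2 (1/x)" and "a' = F1 (1/y)" and "b' = F2 (1/y)"
      have sub: "a + a' - 1 \<le> F1 (1 / (x + y))" "b + b' - 1 \<le> F2 (1 / (x + y))"
        using F1[unfolded 4 class_H_star_iff, THEN conjunct2, rule_format, OF xy]
          F2[unfolded 4 class_H_star_iff, THEN conjunct2, rule_format, OF xy]
        by (simp_all add: a_def b_def a'_def b'_def)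
      have bounds: "0 \<le> a" "a \<le> 1" "0 \<le> b" "b \<le> 1" "0 \<le> a'" "a' \<le> 1" "0 \<le> b'" "b' \<le> 1"
        using nn le1 by (auto simp: a_def b_def a'_def b'_def)
      have "a * b + a' * b' - 1 \<le> F1 (1 / (x + y)) * F2 (1 / (x + y))"
      \<comment> \<open>Only nonnegative lower bounds may be multiplied; otherwise the left-hand side is
         already nonpositive.\<close>
      proof (cases "a + a' \<ge> 1 \<and> b + b' \<ge> 1")
        case True
        have "0 \<le> (1 - a) * (1 - b') + (1 - a') * (1 - b)" using bounds by simp
        then have "a * b + a' * b' - 1 \<le> (a + a' - 1) * (b + b' - 1)" by (simp add: algebra_simps)
        also have "\<dots> \<le> F1 (1 / (x + y)) * F2 (1 / (x + y))"
          using True sub nn by (intro mult_mono) auto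
        finally show ?thesis .
      next
        case False
        have "a * b \<le> a" "a * b \<le> b" "a' * b' \<le> a'" "a' * b' \<le> b'"
          using bounds by (auto intro: mult_left_le mult_left_le_one_le)
        moreover have "0 \<le> F1 (1 / (x + y)) * F2 (1 / (x + y))" using nn by simp
        ultimately show ?thesis using False by linarith
      qed
      then show ?thesis by (simp add: a_def b_def a'_def b'_def)
    qed
    with adm show ?thesis by (simp add: 4 class_H_star_iff)
  qed
qed

section \<open>Concave changes of the reciprocal variable\<close>

lemma convex_combination_pos:
  fixes x y u v :: real
  assumes "x > 0" "y > 0" "u \<ge> 0" "v \<ge> 0" "u + v = 1"
  shows "u * x + v * y > 0"
  using assms by (cases "u = 0") (auto intro: add_pos_nonneg)

text \<open>Concavity is required on the closed half-line with \<open>h 0 = 0\<close>, so that the chord from the origin is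
  available; it yields star-shapedness and from there subadditivity.\<close>

locale concave_change =
  fixes h :: "real \<Rightarrow> real"
  assumes concave: "concave_on {0..} h" and zero: "h 0 = 0" and pos: "x > 0 \<Longrightarrow> h x > 0"
begin

lemma star: "\<theta> * h x \<le> h (\<theta> * x)" if "x > 0" "\<theta> \<in> {0<..<1}"
  using concave_onD[OF concave, of \<theta> 0 x] that by (simp add: zero)

lemma subadditive: "h (x + y) \<le> h x + h y" if "x > 0" "y > 0"
proof -
  have "(x / (x + y)) * h (x + y) \<le> h x" "(y / (x + y)) * h (x + y) \<le> h y"
    using star[of "x + y" "x / (x + y)"] star[of "x + y" "y / (x + y)"] that by auto
  moreover have "(x / (x + y)) * h (x + y) + (y / (x + y)) * h (x + y) = h (x + y)"
    using that by (simp flip: add_divide_distrib distrib_right)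
  ultimately show ?thesis by linarith
qed

lemma class_V_comp:
  assumes F: "F \<in> class_V" and x: "x > 0" and \<theta>: "\<theta> \<in> {0<..<1}"
  shows "\<theta> * inv_survival F (h x) \<le> inv_survival F (h (\<theta> * x))"
proof -
  have "\<theta> * inv_survival F (h x) \<le> inv_survival F (\<theta> * h x)"
    using F pos[OF x] \<theta> by (auto simp: class_V_iff)
  also have "\<dots> \<le> inv_survival F (h (\<theta> * x))"
    using F pos[OF x] \<theta> star[OF x \<theta>] by (intro inv_survival_mono) (auto simp: class_V_iff)
  finally show ?thesis .
qed

lemma class_H_comp:
  assumes F: "F \<in> class_H" and xy: "x > 0" "y > 0" and uv: "u \<ge> 0" "v \<ge> 0" "u + v = 1"
  shows "u * inv_survival F (h x) + v * inv_survival F (h y) \<le> inv_survival F (h (u * x + v * y))"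
proof -
  have A: "admissible_df F" using F by (simp add: class_H_def)
  have "u * inv_survival F (h x) + v * inv_survival F (h y) \<le> inv_survival F (u * h x + v * h y)"
    using F pos xy uv by (auto simp: class_H_def concave_on_iff)
  also have "\<dots> \<le> inv_survival F (h (u * x + v * y))"
  proof (rule inv_survival_mono[OF A])
    show "0 < u * h x + v * h y" using pos xy uv by (simp add: convex_combination_pos)
    show "u * h x + v * h y \<le> h (u * x + v * y)"
      using concave xy uv by (auto simp: concave_on_iff)
  qed
  finally show ?thesis .
qed

lemma class_H_star_comp:
  assumes F: "F \<in> class_H_star" and xy: "x > 0" "y > 0"
  shows "inv_survival F (h (x + y)) \<le> inv_survival F (h x) + inv_survival F (h y)"
proof -
  have A: "admissible_df F" using F by (simp add: class_H_star_def)
  have "inv_survival F (h (x + y)) \<le> inv_survival F (h x + h y)"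
    using xy by (intro inv_survival_mono[OF A] subadditive pos) auto
  also have "\<dots> \<le> inv_survival F (h x) + inv_survival F (h y)"
    using F pos xy by (auto simp: class_H_star_iff)
  finally show ?thesis .
qed

lemma class_G_comp:
  assumes F: "F \<in> class_G" and xy: "x > 0" "y > 0"
  shows "F (1 / h x) * F (1 / h y) \<le> F (1 / h (x + y))"
proof -
  have A: "admissible_df F" using F by (simp add: class_G_def)
  have "F (1 / h x) * F (1 / h y) \<le> F (1 / (h x + h y))"
    using F pos xy by (auto simp: class_G_iff)
  also have "\<dots> \<le> F (1 / h (x + y))"
    using inv_survival_mono[OF A, of "h (x + y)" "h x + h y"] pos[of "x + y"] subadditive xy by simp
  finally show ?thesis .
qed

end

text \<open>The reciprocal of this map is \<open>1 / x + c\<close>, so this is the shift of the argument of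
  \<open>F\<close> by \<open>c\<close>, written in the reciprocal variable.\<close>

lemma concave_change_shift:
  assumes c: "c \<ge> 0"
  shows "concave_change (\<lambda>x. x / (1 + c * x))"
proof
  have nz: "1 + c * x > 0" if "x \<ge> 0" for x
    using c that by (simp add: add_pos_nonneg)
  show "concave_on {0..} (\<lambda>x. x / (1 + c * x))"
  proof (rule f''_le0_imp_concave)
    fix x :: real assume "x \<in> {0..}"
    then have x: "1 + c * x > 0" using nz by simp
    show "((\<lambda>x. x / (1 + c * x)) has_real_derivative 1 / (1 + c * x) ^ 2) (at x)"
      using x by (auto intro!: derivative_eq_intros simp: power2_eq_square)
    show "((\<lambda>x. 1 / (1 + c * x) ^ 2) has_real_derivative - (2 * (1 + c * x) * c) / ((1 + c * x)^2)^2) (at x)"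
      by (rule derivative_eq_intros refl | use x in simp)+
    show "- (2 * (1 + c * x) * c) / ((1 + c * x)^2)^2 \<le> 0" using x c by simp
  qed simp
qed (use c in \<open>auto intro!: divide_pos_pos add_pos_nonneg\<close>)

text \<open>The reciprocal of this map is \<open>max (1 / x) (1 / d)\<close>, so it expresses truncation from below.\<close>

lemma concave_change_min:
  fixes d :: real
  assumes d: "d > 0"
  shows "concave_change (\<lambda>x. min x d)"
proof
  show "concave_on {0..} (\<lambda>x. min x d)"
    unfolding concave_on_iff
  proof (intro conjI ballI allI impI)
    fix x y u v :: real assume uv: "u \<ge> 0" "v \<ge> 0" "u + v = 1"
    have "u * min x d + v * min y d \<le> u * x + v * y" using uv by (intro add_mono mult_left_mono) auto
    moreover have "u * min x d + v * min y d \<le> u * d + v * d" using uv by (intro add_mono mult_left_mono) auto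
    moreover have "u * d + v * d = d" using uv by (simp flip: distrib_right)
    ultimately show "u * min x d + v * min y d \<le> min (u *\<^sub>R x + v *\<^sub>R y) d" by simp
  qed simp
qed (use d in auto)

section \<open>Differences: averages over random shifts\<close>

text \<open>Increasing functions of one random variable are nonnegatively correlated. Let \<open>m\<close> be the mean of
  \<open>u (Y)\<close>. The set where \<open>u\<close> is at most \<open>m\<close> is an initial segment, so some level \<open>k\<close> of \<open>v\<close> separates its
  values there from its values on the complement, and \<open>(u - m) * (v - k)\<close> is pointwise nonnegative.
  Since \<open>u (Y) - m\<close> has mean 0, the choice of \<open>k\<close> does not affect the expectation, which is the covariance.\<close>

lemma (in prob_space) Chebyshev_association:
  fixes u v :: "real \<Rightarrow> real" and Y :: "'a \<Rightarrow> real"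
  assumes Y: "random_variable borel Y"
    and u: "mono u" "\<And>y. 0 \<le> u y" "\<And>y. u y \<le> 1"
    and v: "mono v" "\<And>y. 0 \<le> v y" "\<And>y. v y \<le> 1"
  shows "expectation (\<lambda>\<omega>. u (Y \<omega>)) * expectation (\<lambda>\<omega>. v (Y \<omega>)) \<le> expectation (\<lambda>\<omega>. u (Y \<omega>) * v (Y \<omega>))"
proof -
  note [measurable] = Y borel_measurable_mono[OF u(1)] borel_measurable_mono[OF v(1)]
  have int_u: "integrable M (\<lambda>\<omega>. u (Y \<omega>))"
    by (rule integrable_const_bound[where B = 1]) (use u in auto)
  have int_v: "integrable M (\<lambda>\<omega>. v (Y \<omega>))"
    by (rule integrable_const_bound[where B = 1]) (use v in auto)
  have int_uv: "integrable M (\<lambda>\<omega>. u (Y \<omega>) * v (Y \<omega>))"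
    by (rule integrable_const_bound[where B = 1]) (use u v in \<open>auto simp: abs_mult mult_le_one\<close>)
  define m where "m = expectation (\<lambda>\<omega>. u (Y \<omega>))"
  define L where "L = {y. u y \<le> m}"
  \<comment> \<open>The value 0 is a lower bound of \<open>v\<close> and therefore separates when the segment is empty.\<close>
  define k where "k = (if L = {} then 0 else SUP y\<in>L. v y)"
  have bdd: "bdd_above (v ` L)" using v(3) by (auto simp: bdd_above_def)
  have "0 \<le> (u y - m) * (v y - k)" for y
  proof (cases "y \<in> L")
    case True
    then have "v y \<le> k" by (auto simp: k_def intro: cSUP_upper bdd)
    then show ?thesis using True by (simp add: L_def mult_nonpos_nonpos)
  next
    case False
    have "v z \<le> v y" if "z \<in> L" for z
    proof -
      have "z \<le> y" using False that monoD[OF u(1), of y z] unfolding L_def by force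
      then show ?thesis using monoD[OF v(1)] by blast
    qed
    then have "k \<le> v y" using v(2) by (auto simp: k_def intro: cSUP_least)
    then show ?thesis using False by (simp add: L_def)
  qed
  then have "0 \<le> expectation (\<lambda>\<omega>. (u (Y \<omega>) - m) * (v (Y \<omega>) - k))"
    by (intro integral_nonneg_AE) auto
  also have "(\<lambda>\<omega>. (u (Y \<omega>) - m) * (v (Y \<omega>) - k))
      = (\<lambda>\<omega>. u (Y \<omega>) * v (Y \<omega>) - k * u (Y \<omega>) - m * v (Y \<omega>) + m * k)"
    by (auto simp: algebra_simps)
  also have "expectation \<dots> = expectation (\<lambda>\<omega>. u (Y \<omega>) * v (Y \<omega>)) - k * m - m * expectation (\<lambda>\<omega>. v (Y \<omega>)) + m * k"
    using int_u int_v int_uv by (simp add: m_def prob_space)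
  finally show ?thesis by (simp add: m_def algebra_simps)
qed

text \<open>For each fixed value of \<open>Y\<close> the shifted function satisfies the condition of its class for positive
  arguments, by \<open>concave_change_shift\<close>, and the inequality is integrated over \<open>Y\<close>. Only for G is there
  a product of two integrals, which Chebyshev's inequality bounds by the integral of the product.\<close>

lemma (in prob_space) average_of_shifts_in_class:
  assumes FT: "F \<in> T" and T: "T \<in> {class_G, class_H, class_V, class_H_star}"
    and Y: "random_variable borel Y" and nonneg: "AE \<omega> in M. 0 \<le> Y \<omega>"
    and df: "distribution_function F'"
    and neg: "\<And>x. x < 0 \<Longrightarrow> F' x = 0"
    and mix: "\<And>x. x \<ge> 0 \<Longrightarrow> F' x = expectation (\<lambda>\<omega>. F (x + Y \<omega>))"
  shows "F' \<in> T"
proof -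
  note A = class_imp_admissible[OF FT T]
  note nn = admissible_df_nonneg[OF A] and le1 = admissible_df_le_1[OF A]
  have mono_shift: "mono (\<lambda>y. F (x + y))" for x
    by (auto intro!: monoI admissible_df_mono[OF A])
  have meas: "(\<lambda>\<omega>. F (x + Y \<omega>)) \<in> borel_measurable M" for x
    using measurable_compose[OF Y borel_measurable_mono[OF mono_shift[of x]]] by simp
  have int: "integrable M (\<lambda>\<omega>. F (x + Y \<omega>))" for x
    by (rule integrable_const_bound[where B = 1]) (use nn le1 meas in auto)
  have int_S [simp]: "integrable M (\<lambda>\<omega>. 1 - F (x + Y \<omega>))" for x
    using int by simp
  have surv: "1 - F' x = expectation (\<lambda>\<omega>. 1 - F (x + Y \<omega>))" if "x \<ge> 0" for x
    using mix[OF that] int by (simp add: prob_space)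
  have lt: "F' x < 1" for x
  proof (cases "x < 0")
    case False
    have "expectation (\<lambda>\<omega>. F (x + Y \<omega>)) < 1"
      using class_imp_less_1[OF FT T] by (intro expectation_less int) auto
    then show ?thesis using mix[of x] False by simp
  qed (simp add: neg)
  have adm: "admissible_df F'" using df neg lt by (rule admissible_dfI)
  define h where "h = (\<lambda>c x :: real. x / (1 + c * x))"
  have inv_h: "1 / h c x = 1 / x + c" if "x > 0" for c x
    using that by (simp add: h_def add_divide_distrib)
  have change: "concave_change (h c)" if "c \<ge> 0" for c
    unfolding h_def using that by (rule concave_change_shift)
  consider "T = class_G" | "T = class_H" | "T = class_V" | "T = class_H_star" using T by auto
  then show ?thesis
  proof cases
    case 1
    have "F' (1 / x) * F' (1 / y) \<le> F' (1 / (x + y))" if xy: "x > 0" "y > 0" for x y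
    proof -
      have "F' (1 / x) * F' (1 / y) \<le> expectation (\<lambda>\<omega>. F (1 / x + Y \<omega>) * F (1 / y + Y \<omega>))"
        using xy Chebyshev_association[OF Y mono_shift _ _ mono_shift, of "1 / x" "1 / y"] nn le1
        by (simp add: mix)
      also have "\<dots> \<le> expectation (\<lambda>\<omega>. F (1 / (x + y) + Y \<omega>))"
      proof (rule integral_mono_AE)
        show "integrable M (\<lambda>\<omega>. F (1 / x + Y \<omega>) * F (1 / y + Y \<omega>))"
          by (rule integrable_const_bound[where B = 1])
             (use nn le1 meas in \<open>auto simp: abs_mult intro!: mult_le_one\<close>)
        show "AE \<omega> in M. F (1 / x + Y \<omega>) * F (1 / y + Y \<omega>) \<le> F (1 / (x + y) + Y \<omega>)"
          using nonneg
        proof eventually_elim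
          case (elim \<omega>)
          show ?case
            using concave_change.class_G_comp[OF change[OF elim], of F x y] FT 1 xy
            by (simp add: inv_h)
        qed
      qed (rule int)
      finally show ?thesis using xy by (simp add: mix)
    qed
    with adm show ?thesis by (simp add: 1 class_G_iff)
  next
    case 2
    have "u * (1 - F' (1 / x)) + v * (1 - F' (1 / y)) \<le> 1 - F' (1 / (u * x + v * y))"
      if xy: "x > 0" "y > 0" and uv: "u \<ge> 0" "v \<ge> 0" "u + v = 1" for x y u v :: real
    proof -
      have z: "u * x + v * y > 0" using xy uv by (rule convex_combination_pos)
      have "u * (1 - F' (1 / x)) + v * (1 - F' (1 / y))
          = expectation (\<lambda>\<omega>. u * (1 - F (1 / x + Y \<omega>)) + v * (1 - F (1 / y + Y \<omega>)))"
        using xy by (simp add: surv)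
      also have "\<dots> \<le> expectation (\<lambda>\<omega>. 1 - F (1 / (u * x + v * y) + Y \<omega>))"
      proof (rule integral_mono_AE)
        show "AE \<omega> in M. u * (1 - F (1 / x + Y \<omega>)) + v * (1 - F (1 / y + Y \<omega>))
            \<le> 1 - F (1 / (u * x + v * y) + Y \<omega>)"
          using nonneg
        proof eventually_elim
          case (elim \<omega>)
          show ?case
            using concave_change.class_H_comp[OF change[OF elim], of F x y u v] FT 2 xy uv z
            by (simp add: inv_h)
        qed
      qed simp_all
      finally show ?thesis using z by (simp add: surv)
    qed
    with adm show ?thesis by (auto simp: 2 class_H_def concave_on_iff)
  next
    case 3
    have "\<theta> * (1 - F' (1 / x)) \<le> 1 - F' (1 / (\<theta> * x))" if x: "x > 0" and \<theta>: "\<theta> \<in> {0<..<1}" for x \<theta>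
    proof -
      have z: "\<theta> * x > 0" using x \<theta> by simp
      have "\<theta> * (1 - F' (1 / x)) = expectation (\<lambda>\<omega>. \<theta> * (1 - F (1 / x + Y \<omega>)))"
        using x by (simp add: surv)
      also have "\<dots> \<le> expectation (\<lambda>\<omega>. 1 - F (1 / (\<theta> * x) + Y \<omega>))"
      proof (rule integral_mono_AE)
        show "AE \<omega> in M. \<theta> * (1 - F (1 / x + Y \<omega>)) \<le> 1 - F (1 / (\<theta> * x) + Y \<omega>)"
          using nonneg
        proof eventually_elim
          case (elim \<omega>)
          show ?case
            using concave_change.class_V_comp[OF change[OF elim], of F x \<theta>] FT 3 x \<theta> inv_h[OF z]
            by (simp add: inv_h)
        qed
      qed simp_all
      finally show ?thesis using z surv[of "1 / (\<theta> * x)"] by simp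
    qed
    with adm show ?thesis by (simp add: 3 class_V_iff)
  next
    case 4
    have "1 - F' (1 / (x + y)) \<le> (1 - F' (1 / x)) + (1 - F' (1 / y))" if xy: "x > 0" "y > 0" for x y
    proof -
      have "1 - F' (1 / (x + y)) = expectation (\<lambda>\<omega>. 1 - F (1 / (x + y) + Y \<omega>))"
        using xy by (simp add: surv)
      also have "\<dots> \<le> expectation (\<lambda>\<omega>. (1 - F (1 / x + Y \<omega>)) + (1 - F (1 / y + Y \<omega>)))"
      proof (rule integral_mono_AE)
        show "AE \<omega> in M. 1 - F (1 / (x + y) + Y \<omega>) \<le> (1 - F (1 / x + Y \<omega>)) + (1 - F (1 / y + Y \<omega>))"
          using nonneg
        proof eventually_elim
          case (elim \<omega>)
          show ?case
            using concave_change.class_H_star_comp[OF change[OF elim], of F x y] FT 4 xy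
            by (simp add: inv_h)
        qed
      qed (rule int_S, intro Bochner_Integration.integrable_add int_S)
      also have "\<dots> = expectation (\<lambda>\<omega>. 1 - F (1 / x + Y \<omega>)) + expectation (\<lambda>\<omega>. 1 - F (1 / y + Y \<omega>))"
        by (rule Bochner_Integration.integral_add[OF int_S int_S])
      also have "\<dots> = (1 - F' (1 / x)) + (1 - F' (1 / y))"
        using xy by (simp only: surv zero_le_divide_1_iff less_imp_le)
      finally show ?thesis .
    qed
    with adm show ?thesis by (simp add: 4 class_H_star_iff)
  qed
qed

section \<open>Conditioning\<close>

text \<open>The survival function of \<open>X\<close> given \<open>X > c\<close> is a truncation of that of \<open>X\<close>, divided by a positive
  constant; the conditions of V, H and H* are homogeneous, so the constant is harmless.\<close>

lemma conditioned_in_class: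
  assumes FT: "F \<in> T" and T: "T \<in> {class_V, class_H, class_H_star}" and c: "c > 0"
    and df: "distribution_function F'"
    and F': "\<And>x. survival F' x = survival F (max x c) / survival F c"
  shows "F' \<in> T"
proof -
  have T': "T \<in> {class_G, class_H, class_V, class_H_star}" using T by blast
  note A = class_imp_admissible[OF FT T']
  define s where "s = survival F c"
  have s: "s > 0" using class_imp_less_1[OF FT T', of c] by (simp add: s_def)
  have adm: "admissible_df F'"
  proof (rule admissible_dfI[OF df])
    show "F' x < 1" for x
      using F'[of x] class_imp_less_1[OF FT T'] s unfolding s_def
      by (smt (verit) divide_pos_pos)
    show "F' x = 0" if "x < 0" for x
      using F'[of x] s that c unfolding s_def by (simp add: max_def)
  qed
  define h where "h = (\<lambda>x::real. min x (1 / c))"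
  interpret concave_change h
    unfolding h_def using c by (intro concave_change_min) simp
  have F'_h: "inv_survival F' x = inv_survival F (h x) / s" if "x > 0" for x
  proof -
    have "max (1 / x) c = 1 / h x"
      using that c by (auto simp: h_def max_def min_def field_simps)
    then show ?thesis using F'[of "1 / x"] by (simp add: s_def)
  qed
  consider "T = class_H" | "T = class_V" | "T = class_H_star" using T by auto
  then show ?thesis
  proof cases
    case 1
    have "u * inv_survival F' x + v * inv_survival F' y \<le> inv_survival F' (u * x + v * y)"
      if xy: "x > 0" "y > 0" and uv: "u \<ge> 0" "v \<ge> 0" "u + v = 1" for x y u v :: real
    proof -
      have z: "u * x + v * y > 0" using xy uv by (rule convex_combination_pos)
      show ?thesis
        using class_H_comp[of F x y u v] FT 1 xy uv s
        by (simp only: F'_h[OF z] F'_h[OF xy(1)] F'_h[OF xy(2)])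
           (simp add: divide_right_mono flip: add_divide_distrib)
    qed
    with adm show ?thesis by (auto simp: 1 class_H_def concave_on_iff)
  next
    case 2
    have "\<theta> * inv_survival F' x \<le> inv_survival F' (\<theta> * x)" if x: "x > 0" and \<theta>: "\<theta> \<in> {0<..<1}" for x \<theta>
    proof -
      have z: "\<theta> * x > 0" using x \<theta> by simp
      show ?thesis
        using class_V_comp[of F x \<theta>] FT 2 x \<theta> s
        by (simp only: F'_h[OF z] F'_h[OF x]) (simp add: divide_right_mono)
    qed
    with adm show ?thesis by (simp add: 2 class_V_iff)
  next
    case 3
    have "inv_survival F' (x + y) \<le> inv_survival F' x + inv_survival F' y" if xy: "x > 0" "y > 0" for x y
    proof -
      have z: "x + y > 0" using xy by simp
      show ?thesis
        using class_H_star_comp[of F x y] FT 3 xy s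
        by (simp only: F'_h[OF z] F'_h[OF xy(1)] F'_h[OF xy(2)])
           (simp add: divide_right_mono flip: add_divide_distrib)
    qed
    with adm show ?thesis by (simp add: 3 class_H_star_iff)
  qed
qed

section \<open>Laws of maxima, differences and conditioned variables\<close>

lemma (in prob_space) distribution_function_cdf_distr:
  "random_variable borel X \<Longrightarrow> distribution_function (cdf (distr M borel X))"
  by (auto simp: distribution_function_def)

lemma (in prob_space) cdf_distr_eq:
  "random_variable borel X \<Longrightarrow> cdf (distr M borel X) x = \<P>(\<omega> in M. X \<omega> \<le> x)"
  by (auto simp: cdf_def measure_distr intro!: arg_cong[where f = prob])

lemma (in prob_space) cdf_max:
  fixes X Y :: "'a \<Rightarrow> real"
  assumes indep: "indep_var borel X borel Y"
  shows "cdf (distr M borel (\<lambda>\<omega>. max (X \<omega>) (Y \<omega>))) = (\<lambda>x. cdf (distr M borel X) x * cdf (distr M borel Y) x)"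
proof
  fix x
  have [measurable]: "random_variable borel X" "random_variable borel Y"
    using indep_var_rv1[OF indep] indep_var_rv2[OF indep] by auto
  have "prob ((\<lambda>\<omega>. (X \<omega>, Y \<omega>)) -` ({..x} \<times> {..x}) \<inter> space M)
      = prob (X -` {..x} \<inter> space M) * prob (Y -` {..x} \<inter> space M)"
    by (rule indep_varD[OF indep]) auto
  moreover have "(\<lambda>\<omega>. (X \<omega>, Y \<omega>)) -` ({..x} \<times> {..x}) \<inter> space M
      = (\<lambda>\<omega>. max (X \<omega>) (Y \<omega>)) -` {..x} \<inter> space M"
    by auto
  ultimately show "cdf (distr M borel (\<lambda>\<omega>. max (X \<omega>) (Y \<omega>))) x = cdf (distr M borel X) x * cdf (distr M borel Y) x"
    by (simp add: cdf_def measure_distr)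
qed

lemma (in prob_space) cdf_positive_part_neg:
  fixes Z :: "'a \<Rightarrow> real"
  assumes [measurable]: "random_variable borel Z" and "x < 0"
  shows "cdf (distr M borel (\<lambda>\<omega>. max (Z \<omega>) 0)) x = 0"
  using assms(2) by (subst cdf_distr_eq) auto

text \<open>Fubini for the joint law, with the value of \<open>Y\<close> held fixed: \<open>X - y \<le> x\<close> has probability
  \<open>F (x + y)\<close>, where \<open>F\<close> is the distribution function of \<open>X\<close>.\<close>

lemma (in prob_space) cdf_diff_positive_part:
  fixes X Y :: "'a \<Rightarrow> real"
  assumes indep: "indep_var borel X borel Y" and x: "x \<ge> 0"
  shows "cdf (distr M borel (\<lambda>\<omega>. max (X \<omega> - Y \<omega>) 0)) x
    = expectation (\<lambda>\<omega>. cdf (distr M borel X) (x + Y \<omega>))"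
proof -
  have X [measurable]: "random_variable borel X" and Y [measurable]: "random_variable borel Y"
    using indep_var_rv1[OF indep] indep_var_rv2[OF indep] by auto
  interpret DX: real_distribution "distr M borel X" by simp
  interpret DY: real_distribution "distr M borel Y" by simp
  interpret P: pair_prob_space "distr M borel X" "distr M borel Y" ..
  define B where "B = {p :: real \<times> real. fst p - snd p \<le> x}"
  have "{p \<in> space (borel \<Otimes>\<^sub>M borel). fst p - snd p \<le> x} \<in> sets (borel \<Otimes>\<^sub>M (borel :: real measure))"
    by measurable
  then have B: "B \<in> sets (borel \<Otimes>\<^sub>M borel)"
    by (simp add: B_def space_pair_measure)
  have mono_cdf: "mono (\<lambda>y. cdf (distr M borel X) (x + y))"
    by (auto intro!: monoI DX.cdf_nondecreasing)
  note [measurable] = borel_measurable_mono[OF mono_cdf]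
  have "emeasure M {\<omega> \<in> space M. X \<omega> - Y \<omega> \<le> x}
      = emeasure (distr M (borel \<Otimes>\<^sub>M borel) (\<lambda>\<omega>. (X \<omega>, Y \<omega>))) B"
    using B by (subst emeasure_distr) (auto simp: B_def intro!: arg_cong[where f = "emeasure M"])
  also have "\<dots> = emeasure (distr M borel X \<Otimes>\<^sub>M distr M borel Y) B"
    using indep by (simp add: indep_var_distribution_eq)
  also have "\<dots> = (\<integral>\<^sup>+ y. emeasure (distr M borel X) ((\<lambda>a. (a, y)) -` B) \<partial>distr M borel Y)"
    by (rule P.emeasure_pair_measure_alt2) (use B in simp)
  also have "\<dots> = (\<integral>\<^sup>+ y. ennreal (cdf (distr M borel X) (x + y)) \<partial>distr M borel Y)"
  proof (rule nn_integral_cong)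
    fix y
    have "(\<lambda>a. (a, y)) -` B = {..x + y}" by (auto simp: B_def)
    then show "emeasure (distr M borel X) ((\<lambda>a. (a, y)) -` B) = ennreal (cdf (distr M borel X) (x + y))"
      by (simp add: cdf_def DX.emeasure_eq_measure)
  qed
  also have "\<dots> = (\<integral>\<^sup>+ \<omega>. ennreal (cdf (distr M borel X) (x + Y \<omega>)) \<partial>M)"
    by (subst nn_integral_distr) auto
  also have "\<dots> = ennreal (expectation (\<lambda>\<omega>. cdf (distr M borel X) (x + Y \<omega>)))"
    using measurable_compose[OF Y borel_measurable_mono[OF mono_cdf]]
    by (intro nn_integral_eq_integral integrable_const_bound[where B = 1])
       (auto simp: DX.cdf_nonneg DX.cdf_bounded_prob)
  finally have "prob {\<omega> \<in> space M. X \<omega> - Y \<omega> \<le> x} = expectation (\<lambda>\<omega>. cdf (distr M borel X) (x + Y \<omega>))"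
    by (simp add: emeasure_eq_measure DX.cdf_nonneg)
  moreover have "cdf (distr M borel (\<lambda>\<omega>. max (X \<omega> - Y \<omega>) 0)) x = prob {\<omega> \<in> space M. X \<omega> - Y \<omega> \<le> x}"
    using x by (subst cdf_distr_eq) auto
  ultimately show ?thesis by simp
qed

lemma (in prob_space) cdf_diff_const_positive_part:
  fixes X :: "'a \<Rightarrow> real"
  assumes [measurable]: "random_variable borel X" and x: "x \<ge> 0"
  shows "cdf (distr M borel (\<lambda>\<omega>. max (X \<omega> - c) 0)) x = cdf (distr M borel X) (x + c)"
  using x by (auto simp: cdf_distr_eq algebra_simps intro!: arg_cong[where f = prob])

lemma (in prob_space)
  fixes X :: "'a \<Rightarrow> real"
  assumes X [measurable]: "random_variable borel X"
    and pos: "survival (cdf (distr M borel X)) c > 0"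
  shows prob_space_cond_exceeds: "prob_space (cond_exceeds M X c)"
    and survival_cond_exceeds: "survival (cdf (distr (cond_exceeds M X c) borel X)) x
      = survival (cdf (distr M borel X)) (max x c) / survival (cdf (distr M borel X)) c"
proof -
  have surv: "survival (cdf (distr M borel X)) x = prob {\<omega> \<in> space M. X \<omega> > x}" for x
    using prob_neg[of "\<lambda>\<omega>. X \<omega> \<le> x"] by (simp add: cdf_distr_eq not_le)
  define A where "A = {\<omega> \<in> space M. X \<omega> > c}"
  have A [measurable]: "A \<in> sets M" by (simp add: A_def)
  have prob_A: "prob A > 0" using pos unfolding surv A_def .
  then have em: "emeasure M A \<noteq> 0" "emeasure M A \<noteq> \<infinity>" by (auto simp: emeasure_eq_measure)
  show "prob_space (cond_exceeds M X c)"
    unfolding cond_exceeds_def A_def[symmetric] using em by (rule prob_space_uniform_measure)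
  then interpret C: prob_space "cond_exceeds M X c" .
  have X' [measurable]: "C.random_variable borel X"
    by (simp add: cond_exceeds_def)
  have "survival (cdf (distr (cond_exceeds M X c) borel X)) x = C.prob {\<omega> \<in> space M. X \<omega> > x}"
    using C.prob_neg[of "\<lambda>\<omega>. X \<omega> \<le> x"] by (simp add: C.cdf_distr_eq not_le) (simp add: cond_exceeds_def)
  also have "\<dots> = prob (A \<inter> {\<omega> \<in> space M. X \<omega> > x}) / prob A"
    unfolding cond_exceeds_def A_def[symmetric] using em by (subst measure_uniform_measure) auto
  also have "A \<inter> {\<omega> \<in> space M. X \<omega> > x} = {\<omega> \<in> space M. X \<omega> > max x c}"
    by (auto simp: A_def)
  finally show "survival (cdf (distr (cond_exceeds M X c) borel X)) x
      = survival (cdf (distr M borel X)) (max x c) / survival (cdf (distr M borel X)) c"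
    by (simp only: surv A_def)
qed

theorem proposition3p12:
  fixes M :: "'a measure"
  assumes "prob_space M"
  shows
    \<comment> \<open>(vi)\<close>
    "(\<forall>X\<in>borel_measurable M. \<forall>Y\<in>borel_measurable M.
        prob_space.indep_var M borel X borel Y \<longrightarrow>
        (\<forall>T\<in>{class_G, class_H, class_V, class_H_star}.
           rv_in_class M X T \<and> rv_in_class M Y T \<longrightarrow>
           rv_in_class M (\<lambda>\<omega>. max (X \<omega>) (Y \<omega>)) T))
     \<and>
     \<comment> \<open>(vii)\<close>
     (\<forall>X\<in>borel_measurable M. \<forall>c>0.
        (\<forall>T\<in>{class_H, class_V, class_G, class_H_star}.
           rv_in_class M X T \<longrightarrow> rv_in_class M (\<lambda>\<omega>. max (X \<omega> - c) 0) T))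
     \<and>
     \<comment> \<open>(viii)\<close>
     (\<forall>X\<in>borel_measurable M. \<forall>Y\<in>borel_measurable M.
        prob_space.indep_var M borel X borel Y \<longrightarrow> (AE \<omega> in M. 0 \<le> Y \<omega>) \<longrightarrow>
        (\<forall>T\<in>{class_V, class_H, class_G, class_H_star}.
           rv_in_class M X T \<longrightarrow> rv_in_class M (\<lambda>\<omega>. max (X \<omega> - Y \<omega>) 0) T))
     \<and>
     \<comment> \<open>(ix)\<close>
     (\<forall>X\<in>borel_measurable M. \<forall>c>0.
        (\<forall>T\<in>{class_V, class_H, class_H_star}.
           rv_in_class M X T \<longrightarrow>
           rv_in_class (cond_exceeds M X c) X T \<and>
           \<not> rv_in_class (cond_exceeds M X c) X class_G))"
proof -
  interpret prob_space M by fact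
  show ?thesis
  proof (intro conjI ballI allI impI)
    fix X Y :: "'a \<Rightarrow> real" and T
    assume [measurable]: "X \<in> borel_measurable M" "Y \<in> borel_measurable M"
      and indep: "indep_var borel X borel Y"
      and T: "T \<in> {class_G, class_H, class_V, class_H_star}"
      and XY: "rv_in_class M X T \<and> rv_in_class M Y T"
    have "distribution_function (cdf (distr M borel (\<lambda>\<omega>. max (X \<omega>) (Y \<omega>))))"
      by (rule distribution_function_cdf_distr) simp
    then show "rv_in_class M (\<lambda>\<omega>. max (X \<omega>) (Y \<omega>)) T"
      using XY product_in_class[OF _ _ T] unfolding rv_in_class_def cdf_max[OF indep] by blast
  next
    fix X :: "'a \<Rightarrow> real" and c :: real and T
    assume X [measurable]: "X \<in> borel_measurable M" and c: "c > 0"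
      and T: "T \<in> {class_H, class_V, class_G, class_H_star}" and XT: "rv_in_class M X T"
    show "rv_in_class M (\<lambda>\<omega>. max (X \<omega> - c) 0) T"
      unfolding rv_in_class_def
    proof (rule average_of_shifts_in_class[where Y = "\<lambda>_. c" and F = "cdf (distr M borel X)"])
      show "cdf (distr M borel (\<lambda>\<omega>. max (X \<omega> - c) 0)) x = expectation (\<lambda>\<omega>. cdf (distr M borel X) (x + c))"
        if "x \<ge> 0" for x
        using cdf_diff_const_positive_part[OF X that] by (simp add: prob_space)
    qed (use XT T c in \<open>auto simp: rv_in_class_def intro!: distribution_function_cdf_distr cdf_positive_part_neg\<close>)
  next
    fix X Y :: "'a \<Rightarrow> real" and T
    assume X [measurable]: "X \<in> borel_measurable M" and Y [measurable]: "Y \<in> borel_measurable M"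
      and indep: "indep_var borel X borel Y" and nonneg: "AE \<omega> in M. 0 \<le> Y \<omega>"
      and T: "T \<in> {class_V, class_H, class_G, class_H_star}" and XT: "rv_in_class M X T"
    show "rv_in_class M (\<lambda>\<omega>. max (X \<omega> - Y \<omega>) 0) T"
      unfolding rv_in_class_def
    proof (rule average_of_shifts_in_class[where Y = Y and F = "cdf (distr M borel X)"])
      show "cdf (distr M borel (\<lambda>\<omega>. max (X \<omega> - Y \<omega>) 0)) x = expectation (\<lambda>\<omega>. cdf (distr M borel X) (x + Y \<omega>))"
        if "x \<ge> 0" for x
        using indep that by (rule cdf_diff_positive_part)
    qed (use XT T nonneg in \<open>auto simp: rv_in_class_def intro!: distribution_function_cdf_distr cdf_positive_part_neg\<close>)
  next
    fix X :: "'a \<Rightarrow> real" and c :: real and T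
    assume X [measurable]: "X \<in> borel_measurable M" and c: "c > 0"
      and T: "T \<in> {class_V, class_H, class_H_star}" and XT: "rv_in_class M X T"
    let ?F = "cdf (distr M borel X)" and ?C = "cond_exceeds M X c"
    let ?F' = "cdf (distr ?C borel X)"
    have F: "?F \<in> T" using XT by (simp add: rv_in_class_def)
    have pos: "survival ?F c > 0" using class_imp_less_1[OF F, of c] T by auto
    note F' = survival_cond_exceeds[OF X pos]
    interpret C: prob_space ?C using X pos by (rule prob_space_cond_exceeds)
    have "X \<in> borel_measurable ?C" by (simp add: cond_exceeds_def)
    then have df: "distribution_function ?F'" by (rule C.distribution_function_cdf_distr)
    show "rv_in_class ?C X T"
      unfolding rv_in_class_def using F T c df F' by (rule conditioned_in_class)
    \<comment> \<open>The conditional law has no mass up to \<open>c > 0\<close>, which G excludes.\<close>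
    have "?F' c = 0" using F'[of c] pos by simp
    then show "\<not> rv_in_class ?C X class_G"
      using class_G_pos[of ?F' c] c by (auto simp: rv_in_class_def)
  qed
qed

end
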